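(* There is a numerical (absolute) constant $C_{\rm I}>0$ such that the following holds. Let $A,B\subset\mathbb Z^2$ be finite sets that contain Cartesian rectangles $J_A=J_{A,1}\times J_{A,2}\subset A$ and $J_B=J_{B,1}\times J_{B,2}\subset B$ whose factors are contiguous integer intervals. Set $L_A=\min_i|J_{A,i}|$ and $L_B=\min_i|J_{B,i}|$, and assume $L_A,L_B\ge2$. If the locations $\boldsymbol t_1,\dots,\boldsymbol t_s$ are $\Delta$-separated and $$\Delta\ge\frac{C_{\rm I}}{\min\{\Delta q_1,\Delta q_2\}}\max\{L_A^{-1},L_B^{-1}\},$$ then both Vandermonde factors $V_A$ and $V_B$ have full column rank and $$\mu_1\le C_{\rm I}\max\Big\{\frac{|A|}{L_A^2},\frac{|B|}{L_B^2}\Big\}.$$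
   Context: Fix spacings $\Delta q_1,\Delta q_2>0$ and $s\ge1$ locations $\boldsymbol t_j=(t_{1,j},t_{2,j})^T\in\mathbb R^2$; put $z_{\ell,j}=e^{-\mathrm i\Delta q_\ell t_{\ell,j}}$. For $C\in\{A,B\}$, $V_C\in\mathbb C^{|C|\times s}$ has entries $[V_C]_{\alpha,j}=z_{1,j}^{\alpha_1}z_{2,j}^{\alpha_2}$. If both have full column rank, $\mu_1=\max\{|A|/\lambda_{\min}(V_A^*V_A),\,|B|/\lambda_{\min}(V_B^*V_B)\}$. The periodic distance is $$d_{\rm per}(\boldsymbol t,\boldsymbol t')=\Big[\min_{m\in\mathbb Z}|t_1-t_1'-2\pi m/\Delta q_1|^2+\min_{m\in\mathbb Z}|t_2-t_2'-2\pi m/\Delta q_2|^2\Big]^{1/2}.$$ For $\Delta>0$ the locations are $\Delta$-separated if $d_{\rm per}(\boldsymbol t_j,\boldsymbol t_k)\ge\Delta$ for all $j\ne k$ (for $s=1$, $\Delta>0$ is just a prescribed scale). *)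

theory Defs
  imports
    Complex_Main
    "HOL-Library.Countable_Set"
    "Jordan_Normal_Form.Char_Poly"
    "Jordan_Normal_Form.DL_Rank"
    "Jordan_Normal_Form.Schur_Decomposition"
begin

text \<open>
  The sampling spacings form a pair \<open>dq = (\<Delta>q\<^sub>1, \<Delta>q\<^sub>2)\<close>; the \<open>s\<close> locations are the values
  \<open>t 0, \<dots>, t (s - 1)\<close> of a function into the plane.
\<close>

definition node :: "real \<Rightarrow> real \<Rightarrow> complex" where
  "node q x = exp (- (\<i> * complex_of_real (q * x)))"

text \<open>
  Matrices have rows indexed by natural numbers, so the rows of the Vandermonde factor are listed
  along the library's enumeration \<^const>\<open>from_nat_into\<close>, which for finite \<open>C\<close> is a bijection from
  \<open>{..<card C}\<close> onto \<open>C\<close>. Another ordering of \<open>C\<close> permutes the rows and affects neither the rank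
  nor the Gram matrix.
\<close>

definition vandermonde ::
  "real \<times> real \<Rightarrow> nat \<Rightarrow> (nat \<Rightarrow> real \<times> real) \<Rightarrow> (int \<times> int) set \<Rightarrow> complex mat" where
  "vandermonde dq s t C =
     mat (card C) s (\<lambda>(i, j).
       let \<alpha> = from_nat_into C i
       in node (fst dq) (fst (t j)) powi fst \<alpha> * node (snd dq) (snd (t j)) powi snd \<alpha>)"

definition full_column_rank :: "complex mat \<Rightarrow> bool" where
  "full_column_rank M \<longleftrightarrow> vec_space.rank (dim_row M) M = dim_col M"

text \<open>
  Meant for Hermitian matrices of positive size only: there all eigenvalues are real and the set
  is finite and nonempty.
\<close>

definition lambda_min :: "complex mat \<Rightarrow> real" where
  "lambda_min M = Min {x :: real. eigenvalue M (complex_of_real x)}"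

text \<open>Meaningful only if both Vandermonde factors have full column rank.\<close>

definition mu1 ::
  "real \<times> real \<Rightarrow> nat \<Rightarrow> (nat \<Rightarrow> real \<times> real) \<Rightarrow> (int \<times> int) set \<Rightarrow> (int \<times> int) set \<Rightarrow> real" where
  "mu1 dq s t A B =
     (let VA = vandermonde dq s t A; VB = vandermonde dq s t B
      in max (real (card A) / lambda_min (mat_adjoint VA * VA))
             (real (card B) / lambda_min (mat_adjoint VB * VB)))"

text \<open>The infima over the integers are attained, so they are the minima of the periodic distance.\<close>

definition d_per :: "real \<times> real \<Rightarrow> real \<times> real \<Rightarrow> real \<times> real \<Rightarrow> real" where
  "d_per dq x y =
     sqrt ((INF m::int. \<bar>fst x - fst y - 2 * pi * real_of_int m / fst dq\<bar>\<^sup>2)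
         + (INF m::int. \<bar>snd x - snd y - 2 * pi * real_of_int m / snd dq\<bar>\<^sup>2))"

definition separated ::
  "real \<times> real \<Rightarrow> nat \<Rightarrow> (nat \<Rightarrow> real \<times> real) \<Rightarrow> real \<Rightarrow> bool" where
  "separated dq s t \<Delta> \<longleftrightarrow> (\<forall>j<s. \<forall>k<s. j \<noteq> k \<longrightarrow> d_per dq (t j) (t k) \<ge> \<Delta>)"

definition int_interval :: "int set \<Rightarrow> bool" where
  "int_interval J \<longleftrightarrow> (\<exists>a b. J = {a..b})"

end

theory Submission
  imports Defs "Jordan_Normal_Form.Spectral_Radius"
begin

text \<open>
  For a coefficient vector \<open>v\<close>, the squared norm of \<open>V\<^sub>A v\<close> is the sum over \<open>A\<close> of the squared modulus of
  an exponential sum whose frequencies are the rescaled locations. Dropping rows only decreases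
  it, so \<open>A\<close> may be replaced by a square block whose side is comparable to \<open>L\<close>. It is enough to bound
  the block sum below by a constant times \<open>L\<^sup>2 * \<parallel>v\<parallel>\<^sup>2\<close> (lemma \<open>square_block_lower_bound\<close>): this makes
  the kernel trivial (\<open>full_column_rankI\<close>) and bounds every Rayleigh quotient, hence the smallest
  eigenvalue of the Gram matrix, from below (\<open>lambda_min_ge\<close>).

  The lower bound comes from a large sieve argument. The sharp cutoff to the block is replaced by a
  product of Fejer weights, which are supported in the block. The Gram matrix of the
  exponentials under these weights has, up to phases, entries \<open>D(x)\<^sup>2 * D(y)\<^sup>2\<close>, where \<open>D\<close> is the
  Dirichlet sum of length \<open>M\<close> with \<open>M\<close> about \<open>L / 2\<close>, and \<open>(x, y)\<close> is the difference of two frequencies. On the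
  diagonal this is \<open>M ^ 4\<close>. Off the diagonal, once \<open>x\<close> is reduced modulo \<open>2 * pi\<close> to modulus at most
  \<open>pi\<close>, \<open>\<bar>D(x)\<bar>\<close> is at most \<open>M\<close> and at most \<open>6 / \<bar>x\<bar>\<close>. Sorting the
  other frequencies into grid cells of side half the separation, each cell is hit at most once and the
  central cell not at all, so a row of off-diagonal entries is bounded by
  \<open>M ^ 4 * ((1 + 4 * \<kappa>)\<^sup>2 - 1)\<close>, with \<open>\<kappa>\<close> of order \<open>1 / (M * \<delta>)\<^sup>2\<close> for separation \<open>\<delta>\<close>
  (\<open>sum_dirichlet_separated_le\<close>). The hypothesis on \<open>\<Delta>\<close> makes \<open>M * \<delta>\<close> large, so the matrix is diagonally
  dominant, and \<open>gram_lower_bound\<close> finishes the argument. Because the weights have product form, the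
  sum over cells factors into two convergent one-dimensional sums, although the decay along
  the coordinate axes alone is only quadratic.
\<close>

section \<open>Dirichlet sums\<close>

definition dirichlet_sum :: "nat \<Rightarrow> real \<Rightarrow> complex" where
  "dirichlet_sum M x = (\<Sum>a<M. cis (real a * x))"

lemma norm_dirichlet_sum_le: "cmod (dirichlet_sum M x) \<le> real M"
proof -
  have "cmod (dirichlet_sum M x) \<le> (\<Sum>a<M. cmod (cis (real a * x)))"
    unfolding dirichlet_sum_def by (rule norm_sum)
  then show ?thesis by simp
qed

lemma dirichlet_sum_periodic: "dirichlet_sum M (x - 2 * pi * real_of_int m) = dirichlet_sum M x"
proof -
  have "cis (real a * (x - 2 * pi * real_of_int m)) = cis (real a * x)" for a
  proof -
    have "cis (real a * (x - 2 * pi * real_of_int m))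
        = cis (real a * x) / cis (2 * pi * real_of_int (int a * m))"
      by (simp add: cis_divide algebra_simps)
    also have "cis (2 * pi * real_of_int (int a * m)) = 1"
      by (rule cis_multiple_2pi) simp
    finally show ?thesis by simp
  qed
  then show ?thesis by (simp add: dirichlet_sum_def)
qed

lemma norm_cis_minus_one: "cmod (cis x - 1) = 2 * \<bar>sin (x / 2)\<bar>"
proof -
  have "(cmod (cis x - 1))\<^sup>2 = (cos x - 1)\<^sup>2 + (sin x)\<^sup>2"
    by (simp add: cmod_power2)
  also have "\<dots> = 2 - 2 * cos (2 * (x / 2))"
    using sin_cos_squared_add[of x] by (simp add: power2_eq_square algebra_simps)
  also have "\<dots> = (2 * \<bar>sin (x / 2)\<bar>)\<^sup>2"
    unfolding cos_double_sin by (simp add: power2_eq_square algebra_simps)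
  finally show ?thesis
    by (rule power2_eq_imp_eq) auto
qed

text \<open>
  Jordan's inequality with a worse constant: the cubic Taylor remainder loses at most two thirds
  of \<open>\<bar>x\<bar>\<close>, because \<open>x\<^sup>2 / 6 \<le> 2 / 3\<close> on the interval.
\<close>

lemma abs_sin_ge:
  assumes "\<bar>x\<bar> \<le> pi / 2"
  shows "\<bar>x\<bar> / 3 \<le> \<bar>sin x\<bar>"
proof -
  have "\<bar>sin x - (\<Sum>m<3. sin_coeff m * x ^ m)\<bar> \<le> inverse (fact 3) * \<bar>x\<bar> ^ 3"
    by (rule Maclaurin_sin_bound)
  moreover have "(\<Sum>m<3. sin_coeff m * x ^ m) = x"
    by (simp add: eval_nat_numeral sin_coeff_def)
  moreover have "\<bar>x\<bar> ^ 3 \<le> 4 * \<bar>x\<bar>"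
  proof -
    have "\<bar>x\<bar> \<le> 2" using assms pi_less_4 by linarith
    then have "\<bar>x\<bar>\<^sup>2 \<le> 2\<^sup>2" by (intro power_mono) auto
    then have "\<bar>x\<bar>\<^sup>2 * \<bar>x\<bar> \<le> 4 * \<bar>x\<bar>" by (intro mult_right_mono) auto
    then show ?thesis by (simp add: eval_nat_numeral)
  qed
  moreover have "fact 3 = (6 :: real)" by (simp add: eval_nat_numeral)
  ultimately have "\<bar>sin x - x\<bar> \<le> 2 * \<bar>x\<bar> / 3" by simp
  then show ?thesis by linarith
qed

text \<open>
  Multiplying the geometric sum by \<open>cis x - 1\<close> leaves two unimodular terms, while \<open>cis x\<close> stays away
  from 1 at a rate proportional to the distance of \<open>x\<close> to its nearest multiple of \<open>2 * pi\<close>.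
\<close>

lemma norm_dirichlet_sum_decay:
  assumes "x \<noteq> 0" "\<bar>x\<bar> \<le> pi"
  shows "cmod (dirichlet_sum M x) \<le> 6 / \<bar>x\<bar>"
proof -
  have "(cis x - 1) * dirichlet_sum M x = cis x ^ M - 1"
    unfolding dirichlet_sum_def power_diff_1_eq by (simp add: cis_power_int DeMoivre)
  then have "cmod (cis x - 1) * cmod (dirichlet_sum M x) = cmod (cis x ^ M - 1)"
    by (metis norm_mult)
  also have "\<dots> \<le> 2"
    using norm_triangle_ineq4[of "cis x ^ M" 1] by (simp add: norm_power)
  finally have *: "cmod (cis x - 1) * cmod (dirichlet_sum M x) \<le> 2" .
  have "\<bar>x\<bar> / 3 \<le> cmod (cis x - 1)"
    using abs_sin_ge[of "x / 2"] assms by (simp add: norm_cis_minus_one)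
  then have "\<bar>x\<bar> / 3 * cmod (dirichlet_sum M x) \<le> 2"
    using * by (meson mult_right_mono norm_ge_zero order_trans)
  then show ?thesis using assms by (simp add: field_simps)
qed

section \<open>Inverse-square weights on the lattice\<close>

text \<open>
  Decay of the squared normalised Dirichlet sum over the cells of a grid: it is bounded by 1 on the
  central cell and falls off like an inverse square in the cell number.
\<close>

definition lattice_weight :: "real \<Rightarrow> int \<Rightarrow> real" where
  "lattice_weight \<kappa> m = (if m = 0 then 1 else \<kappa> / (real_of_int m)\<^sup>2)"

lemma lattice_weight_nonneg: "0 \<le> \<kappa> \<Longrightarrow> 0 \<le> lattice_weight \<kappa> m"
  by (simp add: lattice_weight_def)

text \<open>
  The term \<open>1 / N\<close> makes the induction go through, since
  \<open>1 / (N + 1)\<^sup>2 \<le> 1 / N - 1 / (N + 1)\<close> telescopes.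
\<close>

lemma sum_lattice_weight_interval:
  assumes "0 \<le> \<kappa>" "N \<ge> 1"
  shows "(\<Sum>m\<in>{- int N..int N}. lattice_weight \<kappa> m) \<le> 1 + 2 * \<kappa> * (2 - 1 / real N)"
  using \<open>N \<ge> 1\<close>
proof (induction N rule: dec_induct)
  case base
  have "{- int 1..int 1} = {-1, 0, 1}" by auto
  then show ?case by (simp add: lattice_weight_def)
next
  case (step N)
  have "{- int (Suc N)..int (Suc N)} = insert (int N + 1) (insert (- int N - 1) {- int N..int N})"
    by auto
  then have "(\<Sum>m\<in>{- int (Suc N)..int (Suc N)}. lattice_weight \<kappa> m)
      = lattice_weight \<kappa> (int N + 1) + lattice_weight \<kappa> (- int N - 1)
        + (\<Sum>m\<in>{- int N..int N}. lattice_weight \<kappa> m)"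
    by simp
  also have "lattice_weight \<kappa> (int N + 1) + lattice_weight \<kappa> (- int N - 1)
      = 2 * \<kappa> * (1 / (real N + 1)\<^sup>2)"
  proof -
    have "(- real N - 1)\<^sup>2 = (real N + 1)\<^sup>2" by (simp add: power2_eq_square algebra_simps)
    then show ?thesis by (simp add: lattice_weight_def)
  qed
  also have "1 / (real N + 1)\<^sup>2 \<le> 1 / real N - 1 / (real N + 1)"
  proof -
    have "1 / (real N + 1)\<^sup>2 \<le> 1 / (real N * (real N + 1))"
      using step.hyps by (intro divide_left_mono) (auto simp: power2_eq_square)
    also have "\<dots> = 1 / real N - 1 / (real N + 1)"
      using step.hyps by (simp add: field_simps)
    finally show ?thesis .
  qed
  finally have "(\<Sum>m\<in>{- int (Suc N)..int (Suc N)}. lattice_weight \<kappa> m)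
     \<le> 2 * \<kappa> * (1 / real N - 1 / (real N + 1)) + (1 + 2 * \<kappa> * (2 - 1 / real N))"
    using step.IH assms(1) by (simp add: mult_left_mono)
  also have "\<dots> = 1 + 2 * \<kappa> * (2 - 1 / real (Suc N))"
    by (simp add: algebra_simps)
  finally show ?case .
qed

lemma sum_lattice_weight_le:
  assumes "0 \<le> \<kappa>"  and "finite F"
  shows "sum (lattice_weight \<kappa>) F \<le> 1 + 4 * \<kappa>"
proof -
  have "finite (insert 1 (nat ` abs ` F))" using assms by simp
  then obtain N where N: "\<forall>n\<in>insert 1 (nat ` abs ` F). n \<le> N"
    using finite_nat_set_iff_bounded_le by auto
  then have "F \<subseteq> {- int N..int N}" and "N \<ge> 1" by force+
  then have "sum (lattice_weight \<kappa>) F \<le> sum (lattice_weight \<kappa>) {- int N..int N}"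
    using assms by (intro sum_mono2) (auto simp: lattice_weight_nonneg)
  also have "\<dots> \<le> 1 + 2 * \<kappa> * (2 - 1 / real N)"
    by (rule sum_lattice_weight_interval) fact+
  also have "\<dots> \<le> 1 + 2 * \<kappa> * 2"
    using assms(1) by (intro add_left_mono mult_left_mono) auto
  finally show ?thesis by simp
qed

text \<open>
  The sum of the product weights over a whole rectangle factors, and the origin contributes
  exactly 1. So the rest is small with \<open>\<kappa>\<close>, although the weights along the two axes decay in only
  one of the two variables.
\<close>

lemma sum_lattice_weight_plane_le:
  assumes "0 \<le> \<kappa>" "finite F" "(0, 0) \<notin> F"
  shows "(\<Sum>(m, n)\<in>F. lattice_weight \<kappa> m * lattice_weight \<kappa> n) \<le> (1 + 4 * \<kappa>)\<^sup>2 - 1"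
proof -
  let ?w = "lattice_weight \<kappa>" and ?A = "insert 0 (fst ` F)" and ?B = "insert 0 (snd ` F)"
  have fin: "finite ?A" "finite ?B" using assms by auto
  have "1 + (\<Sum>(m, n)\<in>F. ?w m * ?w n) = (\<Sum>(m, n)\<in>insert (0, 0) F. ?w m * ?w n)"
    using assms by (simp add: lattice_weight_def)
  also have "\<dots> \<le> (\<Sum>(m, n)\<in>?A \<times> ?B. ?w m * ?w n)"
    using fin assms(1) by (intro sum_mono2) (auto simp: lattice_weight_nonneg intro: rev_image_eqI)
  also have "\<dots> = sum ?w ?A * sum ?w ?B"
    by (simp add: sum_product sum.cartesian_product)
  also have "\<dots> \<le> (1 + 4 * \<kappa>) * (1 + 4 * \<kappa>)"
    using assms(1) fin
    by (intro mult_mono sum_lattice_weight_le sum_nonneg) (auto simp: lattice_weight_nonneg)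
  finally show ?thesis by (simp add: power2_eq_square)
qed

section \<open>Diagonally dominant Gram matrices\<close>

text \<open>
  Gershgorin's argument in quadratic form. The square of the sum expands into the Gram matrix of
  the functions \<open>\<lambda>p. g p j\<close>; the off-diagonal terms are absorbed by
  \<open>2 * \<bar>c j\<bar> * \<bar>c k\<bar> \<le> \<bar>c j\<bar>\<^sup>2 + \<bar>c k\<bar>\<^sup>2\<close>, and since the Gram matrix is Hermitian its row sums also
  bound its column sums.
\<close>

lemma gram_lower_bound:
  fixes g :: "'p \<Rightarrow> 'j \<Rightarrow> complex" and c :: "'j \<Rightarrow> complex"
  assumes "finite J"
    and diag: "\<And>j. j \<in> J \<Longrightarrow> (\<Sum>p\<in>P. (cmod (g p j))\<^sup>2) = N"
    and off: "\<And>j. j \<in> J \<Longrightarrow> (\<Sum>k\<in>J - {j}. cmod (\<Sum>p\<in>P. g p j * cnj (g p k))) \<le> R"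
  shows "(N - R) * (\<Sum>j\<in>J. (cmod (c j))\<^sup>2) \<le> (\<Sum>p\<in>P. (cmod (\<Sum>j\<in>J. c j * g p j))\<^sup>2)"
proof -
  define G where "G j k = (\<Sum>p\<in>P. g p j * cnj (g p k))" for j k
  let ?c = "\<lambda>j. cmod (c j)"
  have G_sym: "cmod (G k j) = cmod (G j k)" for j k
  proof -
    have "G k j = cnj (G j k)" by (simp add: G_def mult.commute)
    then show ?thesis by simp
  qed
  have G_diag: "G j j = of_real N" if "j \<in> J" for j
    using diag[OF that] unfolding G_def complex_norm_square[symmetric] of_real_sum[symmetric] by simp
  have "complex_of_real (\<Sum>p\<in>P. (cmod (\<Sum>j\<in>J. c j * g p j))\<^sup>2)
      = (\<Sum>p\<in>P. (\<Sum>j\<in>J. c j * g p j) * cnj (\<Sum>k\<in>J. c k * g p k))"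
    unfolding of_real_sum complex_norm_square ..
  also have "\<dots> = (\<Sum>p\<in>P. \<Sum>j\<in>J. \<Sum>k\<in>J. c j * cnj (c k) * (g p j * cnj (g p k)))"
    by (simp add: sum_product mult_ac)
  also have "\<dots> = (\<Sum>j\<in>J. \<Sum>k\<in>J. c j * cnj (c k) * G j k)"
    unfolding G_def sum_distrib_left
    by (subst sum.swap, rule sum.cong[OF refl], subst sum.swap, rule refl)
  also have "\<dots> = (\<Sum>j\<in>J. of_real ((?c j)\<^sup>2 * N) + (\<Sum>k\<in>J - {j}. c j * cnj (c k) * G j k))"
  proof (rule sum.cong[OF refl])
    fix j assume j: "j \<in> J"
    show "(\<Sum>k\<in>J. c j * cnj (c k) * G j k)
        = of_real ((?c j)\<^sup>2 * N) + (\<Sum>k\<in>J - {j}. c j * cnj (c k) * G j k)"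
      unfolding sum.remove[OF \<open>finite J\<close> j] of_real_mult complex_norm_square G_diag[OF j] ..
  qed
  finally have "(\<Sum>p\<in>P. (cmod (\<Sum>j\<in>J. c j * g p j))\<^sup>2)
      = (\<Sum>j\<in>J. (?c j)\<^sup>2 * N + Re (\<Sum>k\<in>J - {j}. c j * cnj (c k) * G j k))"
    by (metis (no_types, lifting) Re_complex_of_real Re_sum plus_complex.sel(1) sum.cong)
  moreover have "(\<Sum>j\<in>J. (?c j)\<^sup>2 * N - (\<Sum>k\<in>J - {j}. ?c j * ?c k * cmod (G j k))) \<le> \<dots>"
  proof (rule sum_mono)
    fix j assume "j \<in> J"
    let ?S = "\<Sum>k\<in>J - {j}. c j * cnj (c k) * G j k"
    have "cmod ?S \<le> (\<Sum>k\<in>J - {j}. ?c j * ?c k * cmod (G j k))"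
      by (rule order_trans[OF norm_sum]) (simp add: norm_mult)
    then show "(?c j)\<^sup>2 * N - (\<Sum>k\<in>J - {j}. ?c j * ?c k * cmod (G j k)) \<le> (?c j)\<^sup>2 * N + Re ?S"
      using abs_Re_le_cmod[of ?S] by linarith
  qed
  moreover have "(\<Sum>j\<in>J. \<Sum>k\<in>J - {j}. ?c j * ?c k * cmod (G j k)) \<le> R * (\<Sum>j\<in>J. (?c j)\<^sup>2)"
  proof -
    let ?T = "\<lambda>f. \<Sum>j\<in>J. \<Sum>k\<in>J - {j}. f j k * cmod (G j k) / 2"
    have AMGM: "?c j * ?c k * r \<le> (?c j)\<^sup>2 * r / 2 + (?c k)\<^sup>2 * r / 2" if "0 \<le> r" for j k r
    proof -
      have "?c j * ?c k \<le> ((?c j)\<^sup>2 + (?c k)\<^sup>2) / 2"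
        using sum_squares_bound[of "?c j" "?c k"] by simp
      from mult_right_mono[OF this that] show ?thesis by (simp add: algebra_simps add_divide_distrib)
    qed
    have "(\<Sum>j\<in>J. \<Sum>k\<in>J - {j}. ?c j * ?c k * cmod (G j k))
        \<le> ?T (\<lambda>j k. (?c j)\<^sup>2) + ?T (\<lambda>j k. (?c k)\<^sup>2)"
      unfolding sum.distrib[symmetric] by (intro sum_mono AMGM) simp
    \<comment> \<open>Exchange of the two indices, using that the Gram matrix is Hermitian.\<close>
    also have "?T (\<lambda>j k. (?c k)\<^sup>2) = ?T (\<lambda>j k. (?c j)\<^sup>2)"
    proof -
      have diff: "J - {j} = {k. k \<in> J \<and> j \<noteq> k}" for j by auto
      show ?thesis unfolding diff
        by (subst sum.swap_restrict[OF \<open>finite J\<close> \<open>finite J\<close>])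
          (auto intro!: sum.cong simp: G_sym)
    qed
    also have "?T (\<lambda>j k. (?c j)\<^sup>2) + ?T (\<lambda>j k. (?c j)\<^sup>2)
        = (\<Sum>j\<in>J. (?c j)\<^sup>2 * (\<Sum>k\<in>J - {j}. cmod (G j k)))"
      unfolding sum.distrib[symmetric] sum_distrib_left by (simp add: mult.commute)
    also have "\<dots> \<le> (\<Sum>j\<in>J. (?c j)\<^sup>2 * R)"
      using off unfolding G_def by (intro sum_mono mult_left_mono) auto
    finally show ?thesis by (simp add: sum_distrib_left mult.commute)
  qed
  ultimately show ?thesis
    by (simp add: sum_subtractf sum_distrib_left algebra_simps)
qed

section \<open>Separated frequencies on the torus\<close>

text \<open>
  On the cell with number \<open>m \<noteq> 0\<close> one has \<open>\<bar>X\<bar> \<ge> (\<bar>m\<bar> - 1 / 2) * h \<ge> \<bar>m\<bar> * h / 2\<close>, so the decay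
  \<open>6 / \<bar>X\<bar>\<close> becomes \<open>12 / (\<bar>m\<bar> * h)\<close>.
\<close>

lemma dirichlet_sum_reduced_le:
  fixes M :: nat and h X :: real
  assumes "M \<ge> 1" "h > 0" "\<bar>X\<bar> \<le> pi"
  shows "(cmod (dirichlet_sum M X))\<^sup>2
    \<le> (real M)\<^sup>2 * lattice_weight ((12 / (real M * h))\<^sup>2) (round (X / h))"
proof (cases "round (X / h) = 0")
  case True
  then show ?thesis by (simp add: lattice_weight_def norm_dirichlet_sum_le power_mono)
next
  case False
  define m where "m = real_of_int (round (X / h))"
  have m: "1 \<le> \<bar>m\<bar>" using False by (simp add: m_def)
  have "\<bar>m - X / h\<bar> \<le> 1 / 2" unfolding m_def by (rule of_int_round_abs_le)
  then have "\<bar>m\<bar> / 2 \<le> \<bar>X / h\<bar>" using m by linarith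
  then have "\<bar>m\<bar> * h / 2 \<le> \<bar>X\<bar>" using assms by (simp add: field_simps)
  moreover have "0 < \<bar>m\<bar> * h / 2" using m assms by simp
  ultimately have "X \<noteq> 0" and "6 / \<bar>X\<bar> \<le> 6 / (\<bar>m\<bar> * h / 2)"
    by (linarith, intro divide_left_mono mult_pos_pos) auto
  then have "cmod (dirichlet_sum M X) \<le> 6 / (\<bar>m\<bar> * h / 2)"
    using norm_dirichlet_sum_decay[of X M] assms by linarith
  then have "(cmod (dirichlet_sum M X))\<^sup>2 \<le> (6 / (\<bar>m\<bar> * h / 2))\<^sup>2"
    by (intro power_mono) auto
  also have "\<dots> = (real M)\<^sup>2 * ((12 / (real M * h))\<^sup>2 / m\<^sup>2)"
    using assms m by (simp add: field_simps power2_eq_square)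
  finally show ?thesis using False by (simp add: lattice_weight_def m_def)
qed

text \<open>
  Separation by the Euclidean distance modulo \<open>2 * pi\<close> in both coordinates, with the minimum over
  the period lattice spelled out as a bound for all lattice translates.
\<close>

definition torus_separated ::
  "'j set \<Rightarrow> ('j \<Rightarrow> real) \<Rightarrow> ('j \<Rightarrow> real) \<Rightarrow> real \<Rightarrow> bool" where
  "torus_separated J x y \<delta> \<longleftrightarrow> (\<forall>j\<in>J. \<forall>k\<in>J. j \<noteq> k \<longrightarrow> (\<forall>m n :: int.
     \<delta>\<^sup>2 \<le> (x j - x k - 2 * pi * of_int m)\<^sup>2 + (y j - y k - 2 * pi * of_int n)\<^sup>2))"

lemma same_cell_dist:
  fixes X X' h :: real
  assumes "h > 0" "round (X / h) = round (X' / h)"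
  shows "(X - X')\<^sup>2 \<le> h\<^sup>2"
proof -
  have "\<bar>X / h - X' / h\<bar> < 1" using assms(2) by (rule round_eq_imp_diff_1)
  then have "\<bar>X - X'\<bar> \<le> \<bar>h\<bar>" using assms(1) by (simp add: field_simps diff_divide_distrib[symmetric])
  then show ?thesis by (rule abs_le_square_iff[THEN iffD1])
qed

text \<open>
  Cut the fundamental square around \<open>(x j, y j)\<close> into cells of side \<open>\<delta> / 2\<close>. Their diameter is below
  \<open>\<delta>\<close>, so each cell holds at most one frequency, and the central cell holds only the one of \<open>j\<close>
  itself. The sum is therefore at most a sum of inverse-square weights over distinct nonzero lattice
  points. The largeness of \<open>real M * \<delta>\<close> makes these weights small, because the cells are much wider
  than the main lobe of the Dirichlet sum, which has width about \<open>1 / M\<close>.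
\<close>

lemma sum_dirichlet_separated_le:
  fixes x y :: "'j \<Rightarrow> real"
  assumes "finite J" "M \<ge> 1" "\<delta> > 0" "120 \<le> real M * \<delta>"
    and sep: "torus_separated J x y \<delta>" and j: "j \<in> J"
  shows "(\<Sum>k\<in>J - {j}. (cmod (dirichlet_sum M (x j - x k)))\<^sup>2 * (cmod (dirichlet_sum M (y j - y k)))\<^sup>2)
    \<le> (real M) ^ 4 / 2"
proof -
  define h where "h = \<delta> / 2"
  have h: "h > 0" using assms(3) by (simp add: h_def)
  define \<kappa> where "\<kappa> = (12 / (real M * h))\<^sup>2"
  have \<kappa>: "0 \<le> \<kappa>" "\<kappa> \<le> 1 / 25"
  proof -
    have "60 \<le> real M * h" using assms(4) by (simp add: h_def)
    then have "12 / (real M * h) \<le> 1 / 5" by (simp add: field_simps)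
    moreover have "0 \<le> 12 / (real M * h)" using h by simp
    ultimately have "\<kappa> \<le> (1 / 5)\<^sup>2" unfolding \<kappa>_def by (intro power_mono)
    then show "\<kappa> \<le> 1 / 25" by (simp add: power2_eq_square)
    show "0 \<le> \<kappa>" by (simp add: \<kappa>_def)
  qed
  \<comment> \<open>The representative modulo \<open>2 * pi\<close> of least absolute value.\<close>
  define red where "red u = u - 2 * pi * real_of_int (round (u / (2 * pi)))" for u
  have red_le: "\<bar>red u\<bar> \<le> pi" for u
  proof -
    have "\<bar>of_int (round (u / (2 * pi))) - u / (2 * pi)\<bar> \<le> 1 / 2" by (rule of_int_round_abs_le)
    then have "\<bar>2 * pi * (of_int (round (u / (2 * pi))) - u / (2 * pi))\<bar> \<le> pi"
      by (simp add: abs_mult)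
    then show ?thesis by (simp add: red_def right_diff_distrib)
  qed
  define X Y where "X k = red (x j - x k)" and "Y k = red (y j - y k)" for k
  define cell where "cell k = (round (X k / h), round (Y k / h))" for k
  \<comment> \<open>Reduced differences in one cell differ by at most \<open>h\<close> in each coordinate, and \<open>2 * h\<^sup>2 = \<delta>\<^sup>2 / 2\<close>.\<close>
  have same: False if "k \<in> J" "l \<in> J" "k \<noteq> l" "cell k = cell l" for k l
  proof -
    have "(X l - X k)\<^sup>2 \<le> h\<^sup>2" "(Y l - Y k)\<^sup>2 \<le> h\<^sup>2"
      using that(4) h by (auto simp: cell_def intro!: same_cell_dist)
    then have "(X l - X k)\<^sup>2 + (Y l - Y k)\<^sup>2 \<le> 2 * h\<^sup>2" by linarith
    moreover have "\<delta>\<^sup>2 \<le> (X l - X k)\<^sup>2 + (Y l - Y k)\<^sup>2"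
    proof -
      \<comment> \<open>The reductions of the two differences cancel up to these periods.\<close>
      define m n where
        "m = round ((x j - x l) / (2 * pi)) - round ((x j - x k) / (2 * pi))" and
        "n = round ((y j - y l) / (2 * pi)) - round ((y j - y k) / (2 * pi))"
      have "X l - X k = x k - x l - 2 * pi * of_int m" "Y l - Y k = y k - y l - 2 * pi * of_int n"
        by (simp_all add: X_def Y_def red_def m_def n_def algebra_simps)
      then show ?thesis using sep that unfolding torus_separated_def by metis
    qed
    ultimately have "\<delta>\<^sup>2 \<le> 2 * h\<^sup>2" by linarith
    also have "\<dots> < \<delta>\<^sup>2" using assms(3) by (simp add: h_def power2_eq_square)
    finally show False by simp
  qed
  have inj: "inj_on cell (J - {j})" using same by (auto simp: inj_on_def)
  have "cell j = (0, 0)" by (simp add: cell_def X_def Y_def red_def)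
  then have origin: "(0, 0) \<notin> cell ` (J - {j})" using same j by force
  let ?w = "lattice_weight \<kappa>"
  have "(cmod (dirichlet_sum M (x j - x k)))\<^sup>2 * (cmod (dirichlet_sum M (y j - y k)))\<^sup>2
      \<le> (real M) ^ 4 * (case cell k of (m, n) \<Rightarrow> ?w m * ?w n)" for k
  proof -
    have eq: "dirichlet_sum M u = dirichlet_sum M (red u)" for u
      unfolding red_def by (rule dirichlet_sum_periodic[symmetric])
    have "(cmod (dirichlet_sum M (red u)))\<^sup>2 \<le> (real M)\<^sup>2 * ?w (round (red u / h))" for u
      unfolding \<kappa>_def by (rule dirichlet_sum_reduced_le[OF assms(2) h red_le])
    then have "(cmod (dirichlet_sum M (red (x j - x k))))\<^sup>2 * (cmod (dirichlet_sum M (red (y j - y k))))\<^sup>2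
      \<le> ((real M)\<^sup>2 * ?w (round (X k / h))) * ((real M)\<^sup>2 * ?w (round (Y k / h)))"
      unfolding X_def Y_def using \<kappa> by (intro mult_mono) (auto simp: lattice_weight_nonneg)
    also have "\<dots> = (real M) ^ 4 * (case cell k of (m, n) \<Rightarrow> ?w m * ?w n)"
      by (simp add: cell_def power2_eq_square eval_nat_numeral)
    finally show ?thesis unfolding eq[symmetric] .
  qed
  then have "(\<Sum>k\<in>J - {j}. (cmod (dirichlet_sum M (x j - x k)))\<^sup>2 * (cmod (dirichlet_sum M (y j - y k)))\<^sup>2)
     \<le> (real M) ^ 4 * (\<Sum>k\<in>J - {j}. case cell k of (m, n) \<Rightarrow> ?w m * ?w n)"
    unfolding sum_distrib_left by (rule sum_mono)
  also have "(\<Sum>k\<in>J - {j}. case cell k of (m, n) \<Rightarrow> ?w m * ?w n)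
      = (\<Sum>(m, n)\<in>cell ` (J - {j}). ?w m * ?w n)"
    using inj by (simp add: sum.reindex)
  also have "\<dots> \<le> (1 + 4 * \<kappa>)\<^sup>2 - 1"
    using \<kappa> assms(1) origin by (intro sum_lattice_weight_plane_le) auto
  also have "\<dots> \<le> (1 + 4 * (1 / 25))\<^sup>2 - 1"
    using \<kappa> by (intro diff_right_mono power_mono) auto
  also have "\<dots> \<le> 1 / 2" by (simp add: power2_eq_square)
  finally show ?thesis by (simp add: mult_left_mono)
qed

text \<open>
  The full block sum is compared with a sum weighted by a product of triangular (Fejer) weights.
  These weights count the representations of a point as a sum of two points of the smaller square
  \<open>{..<M} \<times> {..<M}\<close>. Hence the weighted sum is an average over translates of the smaller square,
  all of which lie inside the block. On the other hand its Gram matrix consists of squared Dirichlet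
  sums, which decay fast enough to be summable in each variable; those of the unweighted block would
  not. The block has side \<open>2 * M - 1\<close>, the number of values of \<open>a + b\<close> for \<open>a, b < M\<close>.
\<close>

lemma square_block_lower_bound:
  fixes x y :: "'j \<Rightarrow> real" and c :: "'j \<Rightarrow> complex" and u v :: int
  assumes "finite J" "M \<ge> 1" "\<delta> > 0" "120 \<le> real M * \<delta>"
    and sep: "torus_separated J x y \<delta>"
    and block: "finite S" "{u..u + 2 * int M - 2} \<times> {v..v + 2 * int M - 2} \<subseteq> S"
  shows "(real M)\<^sup>2 / 2 * (\<Sum>j\<in>J. (cmod (c j))\<^sup>2)
    \<le> (\<Sum>(p, q)\<in>S. (cmod (\<Sum>j\<in>J. c j * cis (of_int p * x j + of_int q * y j)))\<^sup>2)"
proof -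
  let ?Q = "{..<M} \<times> {..<M}"
  define F where "F = (\<lambda>(p, q). (cmod (\<Sum>j\<in>J. c j * cis (of_int p * x j + of_int q * y j)))\<^sup>2)"
  define shift :: "(nat \<times> nat) \<Rightarrow> (nat \<times> nat) \<Rightarrow> int \<times> int" where
    "shift = (\<lambda>(a, a') (b, b'). (u + int a + int b, v + int a' + int b'))"
  define g :: "(nat \<times> nat) \<times> (nat \<times> nat) \<Rightarrow> 'j \<Rightarrow> complex" where
    "g = (\<lambda>(\<alpha>, \<beta>) j. case shift \<alpha> \<beta> of (p, q) \<Rightarrow> cis (of_int p * x j + of_int q * y j))"
  have gram: "(\<Sum>p\<in>?Q \<times> ?Q. g p j * cnj (g p k))
      = cis (of_int u * (x j - x k) + of_int v * (y j - y k))
        * ((dirichlet_sum M (x j - x k))\<^sup>2 * (dirichlet_sum M (y j - y k))\<^sup>2)" for j k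
  proof -
    let ?A = "\<lambda>a::nat. cis (real a * (x j - x k))" and ?B = "\<lambda>a::nat. cis (real a * (y j - y k))"
    let ?z = "cis (of_int u * (x j - x k) + of_int v * (y j - y k))"
    let ?f = "\<lambda>(a, a'). ?A a * ?B a'"
    have "(\<Sum>p\<in>?Q \<times> ?Q. g p j * cnj (g p k)) = (\<Sum>(\<alpha>, \<beta>)\<in>?Q \<times> ?Q. ?z * (?f \<alpha> * ?f \<beta>))"
      by (intro sum.cong refl)
         (auto simp: g_def shift_def cis_cnj cis_mult algebra_simps intro!: arg_cong[where f = cis])
    also have "\<dots> = ?z * (sum ?f ?Q * sum ?f ?Q)"
      by (subst sum_product, subst sum.cartesian_product, subst sum_distrib_left)
         (simp add: case_prod_unfold)
    also have "sum ?f ?Q = dirichlet_sum M (x j - x k) * dirichlet_sum M (y j - y k)"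
      by (simp add: dirichlet_sum_def sum_product sum.cartesian_product)
    finally show ?thesis by (simp add: power2_eq_square mult_ac)
  qed
  \<comment> \<open>The diagonal of the Gram matrix is \<open>M ^ 4\<close>; half of it dominates the off-diagonal row sums.\<close>
  have "((real M) ^ 4 - (real M) ^ 4 / 2) * (\<Sum>j\<in>J. (cmod (c j))\<^sup>2)
      \<le> (\<Sum>p\<in>?Q \<times> ?Q. (cmod (\<Sum>j\<in>J. c j * g p j))\<^sup>2)"
  proof (rule gram_lower_bound[OF \<open>finite J\<close>])
    fix j assume "j \<in> J"
    have "cmod (g p j) = 1" for p by (simp add: g_def split: prod.split)
    then show "(\<Sum>p\<in>?Q \<times> ?Q. (cmod (g p j))\<^sup>2) = (real M) ^ 4"
      by (simp add: card_cartesian_product eval_nat_numeral)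
    have "cmod (\<Sum>p\<in>?Q \<times> ?Q. g p j * cnj (g p k))
        = (cmod (dirichlet_sum M (x j - x k)))\<^sup>2 * (cmod (dirichlet_sum M (y j - y k)))\<^sup>2" for k
      unfolding gram by (simp add: norm_mult norm_power)
    then show "(\<Sum>k\<in>J - {j}. cmod (\<Sum>p\<in>?Q \<times> ?Q. g p j * cnj (g p k))) \<le> (real M) ^ 4 / 2"
      using sum_dirichlet_separated_le[OF assms(1-4) sep \<open>j \<in> J\<close>] by simp
  qed
  also have "\<dots> = (\<Sum>\<alpha>\<in>?Q. \<Sum>\<beta>\<in>?Q. F (shift \<alpha> \<beta>))"
    unfolding sum.cartesian_product
    by (intro sum.cong refl) (auto simp: F_def g_def split: prod.split)
  also have "\<dots> \<le> (\<Sum>\<alpha>\<in>?Q. sum F S)"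
  proof (rule sum_mono)
    fix \<alpha> assume "\<alpha> \<in> ?Q"
    then have sub: "shift \<alpha> ` ?Q \<subseteq> S"
      using block(2) by (fastforce simp: shift_def)
    have "inj_on (shift \<alpha>) ?Q" by (auto simp: inj_on_def shift_def split: prod.splits)
    then have "(\<Sum>\<beta>\<in>?Q. F (shift \<alpha> \<beta>)) = sum F (shift \<alpha> ` ?Q)" by (simp add: sum.reindex)
    also have "\<dots> \<le> sum F S"
      using block(1) sub by (intro sum_mono2) (auto simp: F_def)
    finally show "(\<Sum>\<beta>\<in>?Q. F (shift \<alpha> \<beta>)) \<le> sum F S" .
  qed
  also have "\<dots> = (real M)\<^sup>2 * sum F S"
    by (simp add: card_cartesian_product power2_eq_square)
  finally have "(real M)\<^sup>2 * ((real M)\<^sup>2 / 2 * (\<Sum>j\<in>J. (cmod (c j))\<^sup>2)) \<le> (real M)\<^sup>2 * sum F S"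
    by (simp add: eval_nat_numeral mult_ac)
  then have "(real M)\<^sup>2 / 2 * (\<Sum>j\<in>J. (cmod (c j))\<^sup>2) \<le> sum F S"
    using assms(2) by (subst (asm) mult_le_cancel_left_pos) auto
  then show ?thesis by (simp add: F_def)
qed

section \<open>Rank and smallest eigenvalue from a lower bound\<close>

text \<open>
  Equal columns would put the difference of two unit vectors into the kernel. So the columns are
  distinct, and a linear dependence among them is the same as a nonzero kernel vector.
\<close>

lemma full_column_rankI:
  fixes V :: "complex mat"
  assumes V: "V \<in> carrier_mat n s"
    and inj: "\<And>v. v \<in> carrier_vec s \<Longrightarrow> V *\<^sub>v v = 0\<^sub>v n \<Longrightarrow> v = 0\<^sub>v s"
  shows "full_column_rank V"
proof -
  interpret vec_space "TYPE(complex)" n .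
  have dist: "distinct (cols V)"
    unfolding distinct_conv_nth
  proof (intro allI impI)
    fix i j assume ij: "i < length (cols V)" "j < length (cols V)" "i \<noteq> j"
    then have ij': "i < s" "j < s" using V by auto
    show "cols V ! i \<noteq> cols V ! j"
    proof
      assume "cols V ! i = cols V ! j"
      then have eq: "col V i = col V j" using ij by simp
      have col: "V *\<^sub>v unit_vec s k = col V k" if "k < s" for k
        using V that by (intro eq_vecI) (auto simp: scalar_prod_right_unit)
      have "V *\<^sub>v (unit_vec s i - unit_vec s j) = V *\<^sub>v unit_vec s i - V *\<^sub>v unit_vec s j"
        using V by (intro mult_minus_distrib_mat_vec) auto
      also have "\<dots> = 0\<^sub>v n"
        using V eq ij' by (simp add: col)
      finally have "unit_vec s i - unit_vec s j = (0\<^sub>v s :: complex vec)"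
        by (intro inj) auto
      then have "(unit_vec s i - unit_vec s j) $ i = (0\<^sub>v s :: complex vec) $ i" by simp
      then show False using ij' ij(3) by simp
    qed
  qed
  moreover have "lin_indpt (set (cols V))"
    using lin_depE[OF V _ dist] inj by blast
  ultimately show ?thesis
    using lin_indpt_full_rank[OF V] V by (simp add: full_column_rank_def)
qed

text \<open>
  An eigenvalue with eigenvector \<open>v\<close> is the Rayleigh quotient \<open>\<parallel>V v\<parallel>\<^sup>2 / \<parallel>v\<parallel>\<^sup>2\<close>. This makes every
  complex eigenvalue real, so the set in the definition of \<^const>\<open>lambda_min\<close> is the whole spectrum,
  which is finite and nonempty, and its minimum is itself a Rayleigh quotient.
\<close>

lemma lambda_min_ge:
  fixes V :: "complex mat"
  assumes V: "V \<in> carrier_mat n s" and "s > 0"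
    and lower: "\<And>v. v \<in> carrier_vec s \<Longrightarrow>
      \<gamma> * (\<Sum>j<s. (cmod (v $ j))\<^sup>2) \<le> (\<Sum>i<n. (cmod ((V *\<^sub>v v) $ i))\<^sup>2)"
  shows "\<gamma> \<le> lambda_min (mat_adjoint V * V)"
proof -
  let ?W = "mat_adjoint V"
  let ?M = "?W * V"
  have W: "?W \<in> carrier_mat s n"
    using V by (intro carrier_matI) (simp_all add: mat_adjoint_def)
  have M: "?M \<in> carrier_mat s s" using V W by simp
  have rayleigh: "\<exists>x::real. \<mu> = of_real x \<and> \<gamma> \<le> x" if ev: "eigenvalue ?M \<mu>" for \<mu>
  proof -
    obtain v where v: "v \<in> carrier_vec s" "v \<noteq> 0\<^sub>v s" and eig: "?M *\<^sub>v v = \<mu> \<cdot>\<^sub>v v"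
      using ev M unfolding eigenvalue_def eigenvector_def by auto
    let ?v2 = "\<Sum>j<s. (cmod (v $ j))\<^sup>2" and ?V2 = "\<Sum>i<n. (cmod ((V *\<^sub>v v) $ i))\<^sup>2"
    have Wij: "?W $$ (j, i) = cnj (V $$ (i, j))" if "j < s" "i < n" for i j
      using V that by (simp add: mat_adjoint_def mat_of_rows_index)
    have comp: "\<mu> * v $ j = (\<Sum>i<n. cnj (V $$ (i, j)) * (V *\<^sub>v v) $ i)" if "j < s" for j
    proof -
      have "\<mu> * v $ j = (?M *\<^sub>v v) $ j" using that v by (simp add: eig)
      also have "?M *\<^sub>v v = ?W *\<^sub>v (V *\<^sub>v v)" using W V v(1) by (rule assoc_mult_mat_vec)
      also have "\<dots> $ j = (\<Sum>i<n. ?W $$ (j, i) * (V *\<^sub>v v) $ i)"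
        using W V that by (simp add: scalar_prod_def atLeast0LessThan)
      finally show ?thesis using that by (simp add: Wij)
    qed
    have Vv: "(V *\<^sub>v v) $ i = (\<Sum>j<s. V $$ (i, j) * v $ j)" if "i < n" for i
      using V v that by (simp add: scalar_prod_def atLeast0LessThan)
    have "\<mu> * of_real ?v2 = (\<Sum>j<s. cnj (v $ j) * (\<mu> * v $ j))"
      by (simp add: complex_norm_square sum_distrib_left mult_ac del: of_real_power)
    also have "\<dots> = (\<Sum>j<s. \<Sum>i<n. cnj (V $$ (i, j) * v $ j) * (V *\<^sub>v v) $ i)"
      by (simp add: comp sum_distrib_left mult_ac)
    also have "\<dots> = (\<Sum>i<n. cnj (\<Sum>j<s. V $$ (i, j) * v $ j) * (V *\<^sub>v v) $ i)"
      by (subst sum.swap) (simp add: sum_distrib_right)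
    also have "\<dots> = (\<Sum>i<n. cnj ((V *\<^sub>v v) $ i) * (V *\<^sub>v v) $ i)"
      by (intro sum.cong refl) (simp add: Vv)
    also have "\<dots> = of_real ?V2"
      by (simp add: complex_norm_square mult_ac del: of_real_power)
    finally have key: "\<mu> * of_real ?v2 = of_real ?V2" .
    obtain i where "i < s" "v $ i \<noteq> 0"
      using v by (metis carrier_vecD eq_vecI index_zero_vec(1) index_zero_vec(2))
    then have "0 < ?v2" by (intro sum_pos2[of _ i]) auto
    then have "complex_of_real ?v2 \<noteq> 0" by (simp only: of_real_eq_0_iff less_imp_neq[symmetric] not_False_eq_True)
    then have "\<mu> = of_real (?V2 / ?v2)"
      unfolding of_real_divide using key by (rule iffD2[OF nonzero_eq_divide_eq])
    moreover have "\<gamma> \<le> ?V2 / ?v2" using lower[OF v(1)] \<open>0 < ?v2\<close> by (simp add: field_simps)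
    ultimately show ?thesis by blast
  qed
  let ?E = "{x :: real. eigenvalue ?M (complex_of_real x)}"
  have "complex_of_real ` ?E \<subseteq> spectrum ?M" by (auto simp: spectrum_def)
  then have "finite (complex_of_real ` ?E)"
    using card_finite_spectrum(1)[OF M] finite_subset by blast
  then have fin: "finite ?E" by (rule finite_imageD) (simp add: inj_on_def)
  have "?E \<noteq> {}"
    using spectrum_non_empty[OF M \<open>s > 0\<close>] rayleigh unfolding spectrum_def by fastforce
  then have "lambda_min ?M \<in> ?E"
    unfolding lambda_min_def using fin Min_in by blast
  then show ?thesis using rayleigh by fastforce
qed

section \<open>Vandermonde matrices of separated locations\<close>

lemma node_powi: "node q r powi k = cis (of_int k * (- (q * r)))"
proof -
  have "node q r = cis (- (q * r))" by (simp add: node_def cis_conv_exp)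
  then show ?thesis by (simp add: cis_power_int)
qed

text \<open>
  The frequencies \<open>- q\<^sub>\<ell> t\<^sub>\<ell>\<close> rescale the coordinates, and periods \<open>2 * pi / q\<^sub>\<ell>\<close> become
  \<open>2 * pi\<close>. The anisotropic rescaling shrinks distances by at most the smaller spacing.
\<close>

lemma separated_imp_torus_separated:
  assumes q: "fst dq > 0" "snd dq > 0" and "\<Delta> > 0" and sep: "separated dq s t \<Delta>"
  shows "torus_separated {..<s} (\<lambda>j. - (fst dq * fst (t j))) (\<lambda>j. - (snd dq * snd (t j)))
    (min (fst dq) (snd dq) * \<Delta>)"
  unfolding torus_separated_def
proof (intro ballI impI allI)
  fix j k and m n :: int
  assume jk: "j \<in> {..<s}" "k \<in> {..<s}" "j \<noteq> k"
  define q where "q = min (fst dq) (snd dq)"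
  have q0: "q > 0" using q by (simp add: q_def)
  have INF_le: "(INF m::int. \<bar>r - 2 * pi * real_of_int m / p\<bar>\<^sup>2) \<le> \<bar>r - 2 * pi * real_of_int l / p\<bar>\<^sup>2"
    for r p :: real and l :: int
    by (intro cINF_lower bdd_belowI2[where m = 0]) auto
  have scale: "q\<^sup>2 * \<bar>r - 2 * pi * real_of_int l / p\<bar>\<^sup>2 \<le> (p * r - 2 * pi * real_of_int l)\<^sup>2"
    if "q \<le> p" for r p l
  proof -
    have "q\<^sup>2 * \<bar>r - 2 * pi * real_of_int l / p\<bar>\<^sup>2 \<le> p\<^sup>2 * \<bar>r - 2 * pi * real_of_int l / p\<bar>\<^sup>2"
      using that q0 by (intro mult_right_mono power_mono) auto
    also have "\<dots> = (p * (r - 2 * pi * real_of_int l / p))\<^sup>2"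
      by (simp add: power_mult_distrib)
    also have "p * (r - 2 * pi * real_of_int l / p) = p * r - 2 * pi * real_of_int l"
      using that q0 by (simp add: field_simps)
    finally show ?thesis .
  qed
  let ?r = "fst (t j) - fst (t k)" and ?r' = "snd (t j) - snd (t k)"
  have "\<Delta> \<le> d_per dq (t j) (t k)" using sep jk by (auto simp: separated_def)
  also have "\<dots> \<le> sqrt (\<bar>?r - 2 * pi * real_of_int (- m) / fst dq\<bar>\<^sup>2
      + \<bar>?r' - 2 * pi * real_of_int (- n) / snd dq\<bar>\<^sup>2)"
    unfolding d_per_def by (intro real_sqrt_le_mono add_mono INF_le)
  finally have "\<Delta>\<^sup>2 \<le> \<bar>?r - 2 * pi * real_of_int (- m) / fst dq\<bar>\<^sup>2
      + \<bar>?r' - 2 * pi * real_of_int (- n) / snd dq\<bar>\<^sup>2"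
    using \<open>\<Delta> > 0\<close> by (metis less_eq_real_def real_sqrt_le_iff real_sqrt_unique)
  then have "q\<^sup>2 * \<Delta>\<^sup>2 \<le> q\<^sup>2 * \<bar>?r - 2 * pi * real_of_int (- m) / fst dq\<bar>\<^sup>2
      + q\<^sup>2 * \<bar>?r' - 2 * pi * real_of_int (- n) / snd dq\<bar>\<^sup>2"
    unfolding distrib_left[symmetric] by (rule mult_left_mono) simp
  also have "\<dots> \<le> (fst dq * ?r - 2 * pi * real_of_int (- m))\<^sup>2
      + (snd dq * ?r' - 2 * pi * real_of_int (- n))\<^sup>2"
    by (intro add_mono scale) (auto simp: q_def)
  also have "\<dots> = (- (fst dq * fst (t j)) - - (fst dq * fst (t k)) - 2 * pi * of_int m)\<^sup>2
      + (- (snd dq * snd (t j)) - - (snd dq * snd (t k)) - 2 * pi * of_int n)\<^sup>2"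
    by (simp add: power2_eq_square algebra_simps)
  finally show "(min (fst dq) (snd dq) * \<Delta>)\<^sup>2 \<le> \<dots>"
    by (simp add: q_def power_mult_distrib)
qed

lemma int_interval_initial:
  assumes "int_interval J" "int n \<le> int (card J)" "n \<ge> 1"
  obtains u where "{u..u + int n - 1} \<subseteq> J"
proof -
  obtain a b where J: "J = {a..b}" using assms(1) by (auto simp: int_interval_def)
  then have "a + int n - 1 \<le> b" using assms by (auto split: if_splits)
  then show ?thesis using that[of a] J by auto
qed

text \<open>
  Taking \<open>M = (L + 1) div 2\<close> makes the side \<open>2 * M - 1\<close> fit into \<open>L\<close> while \<open>M \<ge> L / 2\<close>, which turns
  \<open>M\<^sup>2 / 2\<close> into \<open>L\<^sup>2 / 8\<close>. The rows outside the block only increase the right-hand side.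
\<close>

lemma vandermonde_lower_bound:
  assumes q: "fst dq > 0" "snd dq > 0" and \<Delta>: "\<Delta> > 0" and fin: "finite A"
    and J: "int_interval J1" "int_interval J2" "J1 \<times> J2 \<subseteq> A"
    and L: "L = min (card J1) (card J2)" "L \<ge> 2"
    and sep: "separated dq s t \<Delta>" and large: "240 \<le> min (fst dq) (snd dq) * \<Delta> * real L"
    and v: "v \<in> carrier_vec s"
  shows "(real L)\<^sup>2 / 8 * (\<Sum>j<s. (cmod (v $ j))\<^sup>2)
    \<le> (\<Sum>i<card A. (cmod ((vandermonde dq s t A *\<^sub>v v) $ i))\<^sup>2)"
proof -
  let ?x = "\<lambda>j. - (fst dq * fst (t j))" and ?y = "\<lambda>j. - (snd dq * snd (t j))"
  define M where "M = (L + 1) div 2"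
  have M: "M \<ge> 1" "2 * M - 1 \<le> L" "L \<le> 2 * M" using L(2) by (auto simp: M_def)
  have card: "int (2 * M - 1) \<le> int (card J1)" "int (2 * M - 1) \<le> int (card J2)" "2 * M - 1 \<ge> 1"
    using M L(1) by auto
  obtain u1 where u1: "{u1..u1 + int (2 * M - 1) - 1} \<subseteq> J1"
    using int_interval_initial[OF J(1) card(1,3)] .
  obtain u2 where u2: "{u2..u2 + int (2 * M - 1) - 1} \<subseteq> J2"
    using int_interval_initial[OF J(2) card(2,3)] .
  let ?F = "\<lambda>(p, q). (cmod (\<Sum>j<s. v $ j * cis (of_int p * ?x j + of_int q * ?y j)))\<^sup>2"
  have "(real L)\<^sup>2 / 8 \<le> (real M)\<^sup>2 / 2"
  proof -
    have "(real L)\<^sup>2 \<le> (2 * real M)\<^sup>2" using M by (intro power_mono) auto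
    then show ?thesis by (simp add: power_mult_distrib)
  qed
  then have "(real L)\<^sup>2 / 8 * (\<Sum>j<s. (cmod (v $ j))\<^sup>2) \<le> (real M)\<^sup>2 / 2 * (\<Sum>j<s. (cmod (v $ j))\<^sup>2)"
    by (intro mult_right_mono sum_nonneg) auto
  also have "\<dots> \<le> (\<Sum>(p, q)\<in>A. (cmod (\<Sum>j<s. v $ j * cis (of_int p * ?x j + of_int q * ?y j)))\<^sup>2)"
  proof (rule square_block_lower_bound)
    let ?\<delta> = "min (fst dq) (snd dq) * \<Delta>"
    show \<delta>: "0 < ?\<delta>" using q \<Delta> by simp
    have "?\<delta> * real L \<le> ?\<delta> * (2 * real M)" using M \<delta> by (intro mult_left_mono) auto
    then show "120 \<le> real M * ?\<delta>" using large by (simp add: mult_ac)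
    show "torus_separated {..<s} ?x ?y ?\<delta>"
      by (rule separated_imp_torus_separated) fact+
    have "{u1..u1 + 2 * int M - 2} \<times> {u2..u2 + 2 * int M - 2} \<subseteq> J1 \<times> J2"
      using u1 u2 M by (intro Sigma_mono) (auto simp: of_nat_diff algebra_simps)
    then show "{u1..u1 + 2 * int M - 2} \<times> {u2..u2 + 2 * int M - 2} \<subseteq> A" using J(3) by blast
  qed (use M fin in auto)
  also have "\<dots> = (\<Sum>i<card A. ?F (from_nat_into A i))"
    by (rule sum.reindex_bij_betw[OF bij_betw_from_nat_into_finite[OF fin], symmetric])
  also have "\<dots> = (\<Sum>i<card A. (cmod ((vandermonde dq s t A *\<^sub>v v) $ i))\<^sup>2)"
  proof (rule sum.cong[OF refl])
    fix i assume "i \<in> {..<card A}"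
    then have "(vandermonde dq s t A *\<^sub>v v) $ i = (\<Sum>j<s. v $ j *
        cis (of_int (fst (from_nat_into A i)) * ?x j + of_int (snd (from_nat_into A i)) * ?y j))"
      using v by (simp add: vandermonde_def scalar_prod_def atLeast0LessThan Let_def node_powi cis_mult
          mult.commute)
    then show "?F (from_nat_into A i) = (cmod ((vandermonde dq s t A *\<^sub>v v) $ i))\<^sup>2"
      by (simp add: case_prod_unfold)
  qed
  finally show ?thesis .
qed

lemma vandermonde_conditioning:
  assumes q: "fst dq > 0" "snd dq > 0" and \<Delta>: "\<Delta> > 0" and fin: "finite A"
    and J: "int_interval J1" "int_interval J2" "J1 \<times> J2 \<subseteq> A"
    and L: "L = min (card J1) (card J2)" "L \<ge> 2"
    and sep: "separated dq s t \<Delta>" and large: "240 \<le> min (fst dq) (snd dq) * \<Delta> * real L"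
    and s: "s \<ge> 1"
  shows "full_column_rank (vandermonde dq s t A)"
    and "real (card A) / lambda_min (mat_adjoint (vandermonde dq s t A) * vandermonde dq s t A)
      \<le> 8 * (real (card A) / (real L)\<^sup>2)"
proof -
  let ?V = "vandermonde dq s t A"
  have V: "?V \<in> carrier_mat (card A) s" by (simp add: vandermonde_def)
  note lower = vandermonde_lower_bound[OF assms(1-11)]
  have Lpos: "0 < (real L)\<^sup>2 / 8" using L(2) by simp
  show "full_column_rank ?V"
  proof (rule full_column_rankI[OF V])
    fix v :: "complex vec" assume v: "v \<in> carrier_vec s" and "?V *\<^sub>v v = 0\<^sub>v (card A)"
    then have "(real L)\<^sup>2 / 8 * (\<Sum>j<s. (cmod (v $ j))\<^sup>2) \<le> 0" using lower[OF v] by simp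
    then have "(\<Sum>j<s. (cmod (v $ j))\<^sup>2) \<le> 0" using Lpos by (simp add: mult_le_0_iff)
    then have "(\<Sum>j<s. (cmod (v $ j))\<^sup>2) = 0" by (intro antisym sum_nonneg) auto
    then have "\<forall>j<s. v $ j = 0" by (subst (asm) sum_nonneg_eq_0_iff) auto
    then show "v = 0\<^sub>v s" using v by (intro eq_vecI) auto
  qed
  have "(real L)\<^sup>2 / 8 \<le> lambda_min (mat_adjoint ?V * ?V)"
    using s by (intro lambda_min_ge[OF V] lower) auto
  then have "real (card A) / lambda_min (mat_adjoint ?V * ?V) \<le> real (card A) / ((real L)\<^sup>2 / 8)"
    using Lpos less_le_trans[OF Lpos] by (intro divide_left_mono mult_pos_pos) auto
  then show "real (card A) / lambda_min (mat_adjoint ?V * ?V) \<le> 8 * (real (card A) / (real L)\<^sup>2)"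
    by (simp add: mult.commute)
qed

theorem proposition4p3:
  shows "\<exists>C\<^sub>I :: real. C\<^sub>I > 0 \<and>
    (\<forall>(dq :: real \<times> real) (s :: nat) (t :: nat \<Rightarrow> real \<times> real) (\<Delta> :: real)
       (A :: (int \<times> int) set) (B :: (int \<times> int) set)
       (JA1 :: int set) (JA2 :: int set) (JB1 :: int set) (JB2 :: int set) (LA :: nat) (LB :: nat).
       fst dq > 0 \<longrightarrow> snd dq > 0 \<longrightarrow> s \<ge> 1 \<longrightarrow> \<Delta> > 0 \<longrightarrow>
       finite A \<longrightarrow> finite B \<longrightarrow>
       int_interval JA1 \<longrightarrow> int_interval JA2 \<longrightarrow> int_interval JB1 \<longrightarrow> int_interval JB2 \<longrightarrow>
       JA1 \<times> JA2 \<subseteq> A \<longrightarrow> JB1 \<times> JB2 \<subseteq> B \<longrightarrow>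
       LA = min (card JA1) (card JA2) \<longrightarrow> LB = min (card JB1) (card JB2) \<longrightarrow>
       LA \<ge> 2 \<longrightarrow> LB \<ge> 2 \<longrightarrow>
       separated dq s t \<Delta> \<longrightarrow>
       \<Delta> \<ge> C\<^sub>I / min (fst dq) (snd dq) * max (1 / real LA) (1 / real LB) \<longrightarrow>
       full_column_rank (vandermonde dq s t A) \<and>
       full_column_rank (vandermonde dq s t B) \<and>
       mu1 dq s t A B \<le> C\<^sub>I * max (real (card A) / (real LA)\<^sup>2) (real (card B) / (real LB)\<^sup>2))"
  \<comment> \<open>With \<open>M \<ge> L / 2\<close> the value 240 gives \<open>M * \<delta> \<ge> 120\<close>, hence cells of side \<open>h\<close> with
     \<open>M * h \<ge> 60\<close> and weights \<open>\<kappa> \<le> (12 / 60)\<^sup>2 = 1 / 25\<close>, for which \<open>(1 + 4 * \<kappa>)\<^sup>2 - 1 < 1 / 2\<close>.\<close>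
proof (intro exI[of _ "240 :: real"] conjI allI impI)
  show "(0::real) < 240" by simp
next
  fix dq :: "real \<times> real" and s t \<Delta> A B JA1 JA2 JB1 JB2 and LA LB :: nat
  assume q: "fst dq > 0" "snd dq > 0" and s: "s \<ge> 1" and \<Delta>: "\<Delta> > 0" and fin: "finite A" "finite B"
    and JA: "int_interval JA1" "int_interval JA2" and JB: "int_interval JB1" "int_interval JB2"
    and sub: "JA1 \<times> JA2 \<subseteq> A" "JB1 \<times> JB2 \<subseteq> B"
    and L: "LA = min (card JA1) (card JA2)" "LB = min (card JB1) (card JB2)" "LA \<ge> 2" "LB \<ge> 2"
    and sep: "separated dq s t \<Delta>"
    and sc: "\<Delta> \<ge> 240 / min (fst dq) (snd dq) * max (1 / real LA) (1 / real LB)"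
  have large: "240 \<le> min (fst dq) (snd dq) * \<Delta> * real K"
    if "1 / real K \<le> max (1 / real LA) (1 / real LB)" "K \<ge> 2" for K
  proof -
    have "240 / min (fst dq) (snd dq) * (1 / real K) \<le> \<Delta>"
      using that(1) q by (intro order_trans[OF mult_left_mono sc]) auto
    then show ?thesis using q that(2) by (simp add: field_simps del: min_less_iff_conj)
  qed
  note condA = vandermonde_conditioning[OF q \<Delta> fin(1) JA sub(1) L(1,3) sep large[OF max.cobounded1 L(3)] s]
  note condB = vandermonde_conditioning[OF q \<Delta> fin(2) JB sub(2) L(2,4) sep large[OF max.cobounded2 L(4)] s]
  show "full_column_rank (vandermonde dq s t A)" "full_column_rank (vandermonde dq s t B)"
    by (fact condA condB)+
  define a b where "a = real (card A) / (real LA)\<^sup>2" and "b = real (card B) / (real LB)\<^sup>2"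
  have "a \<ge> 0" "b \<ge> 0" by (simp_all add: a_def b_def)
  have "mu1 dq s t A B \<le> max (8 * a) (8 * b)"
    unfolding mu1_def Let_def a_def b_def by (rule max.mono[OF condA(2) condB(2)])
  also have "\<dots> \<le> 240 * max a b"
    using \<open>a \<ge> 0\<close> \<open>b \<ge> 0\<close> by linarith
  finally show "mu1 dq s t A B
      \<le> 240 * max (real (card A) / (real LA)\<^sup>2) (real (card B) / (real LB)\<^sup>2)"
    unfolding a_def b_def .
qed

end
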